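(* There is an absolute constant $C>0$ such that the following holds. Let $2\le q<\infty$, let $K\in\mathcal K_q$ be a kernel on $\Omega^1\times\Omega^2$ with $|\Omega^1|=1$ such that $$\|K(\mathbf x,\cdot)\|_{L_q(\Omega^2)}\le 1\quad\text{for all }\mathbf x\in\Omega^1,$$ and assume that $J_K\in X(K,q)$. Then for every $m\in\mathbb N$ there exist points $\xi^1,\dots,\xi^m\in\Omega^1$ such that $$D(\xi,Q,K,q)=\Big\|\int_{\Omega^1}K(\mathbf x,\cdot)\,d\mathbf x-\frac1m\sum_{\mu=1}^mK(\xi^\mu,\cdot)\Big\|_{L_q(\Omega^2)}\le C q^{1/2}m^{-1/2}.$$
   Context: $\Omega^1,\Omega^2$ are Lebesgue measurable subsets of Euclidean spaces, and $|\Omega^1|$ is the Lebesgue measure of $\Omega^1$. For $1\le q\le\infty$, $\mathcal K_q$ is the set of measurable functions $K(\mathbf x,\mathbf y)$ on $\Omega^1\times\Omega^2$ such that: $K(\mathbf x,\cdot)\in L_q(\Omega^2)$ for every $\mathbf x\in\Omega^1$; $K(\cdot,\mathbf y)$ is integrable over $\Omega^1$ for every $\mathbf y\in\Omega^2$; and the function $J_K(\mathbf y):=\int_{\Omega^1}K(\mathbf x,\mathbf y)\,d\mathbf x$ belongs to $L_q(\Omega^2)$. $X(K,q)$ denotes the $L_q(\Omega^2)$-closure of the linear span of $\{K(\mathbf x,\cdot):\mathbf x\in\Omega^1\}$. $D(\xi,Q,K,q)$ denotes the $(K,q)$-discrepancy of the points $\xi=(\xi^1,\dots,\xi^m)$ with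 equal weights $1/m$, i.e. the norm displayed in the claim. *)

theory Defs
  imports "HOL-Analysis.Analysis"
begin

(* Lebesgue measure on R^d, whose points are the functions on {..<d} (extended by undefined).
   The dimension is a term and not a type, so that a constant can be chosen before, and hence
   independently of, the dimensions. *)
definition leb :: "nat \<Rightarrow> (nat \<Rightarrow> real) measure" where
  "leb d = completion (\<Pi>\<^sub>M i\<in>{..<d}. lborel)"

abbreviation leb_on :: "nat \<Rightarrow> (nat \<Rightarrow> real) set \<Rightarrow> (nat \<Rightarrow> real) measure" where
  "leb_on d \<Omega> \<equiv> restrict_space (leb d) \<Omega>"

(* Only finite exponents q are covered. Elements are functions, not classes modulo null sets. *)
definition Lq_space :: "real \<Rightarrow> 'b measure \<Rightarrow> ('b \<Rightarrow> real) set" where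
  "Lq_space q N = {f \<in> borel_measurable N. integrable N (\<lambda>y. \<bar>f y\<bar> powr q)}"

(* Meaningful only on Lq_space q N: the Bochner integral is 0 if the integrand is not integrable. *)
definition Lq_norm :: "real \<Rightarrow> 'b measure \<Rightarrow> ('b \<Rightarrow> real) \<Rightarrow> real" where
  "Lq_norm q N f = (\<integral>y. \<bar>f y\<bar> powr q \<partial>N) powr (1 / q)"

definition kernel_integral :: "'a measure \<Rightarrow> ('a \<Rightarrow> 'b \<Rightarrow> real) \<Rightarrow> 'b \<Rightarrow> real" where
  "kernel_integral M K = (\<lambda>y. \<integral>x. K x y \<partial>M)"

(* For M = leb_on d1 \<Omega>1 and N = leb_on d2 \<Omega>2 the completed product is Lebesgue measure of
   R^(d1+d2) on \<Omega>1 \<times> \<Omega>2, so joint measurability is Lebesgue measurability in both variables. *)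
definition kernel_class :: "'a measure \<Rightarrow> 'b measure \<Rightarrow> real \<Rightarrow> ('a \<Rightarrow> 'b \<Rightarrow> real) set" where
  "kernel_class M N q = {K.
     (\<lambda>(x, y). K x y) \<in> borel_measurable (completion (M \<Otimes>\<^sub>M N)) \<and>
     (\<forall>x\<in>space M. K x \<in> Lq_space q N) \<and>
     (\<forall>y\<in>space N. integrable M (\<lambda>x. K x y)) \<and>
     kernel_integral M K \<in> Lq_space q N}"

definition kernel_span :: "'a set \<Rightarrow> ('a \<Rightarrow> 'b \<Rightarrow> real) \<Rightarrow> ('b \<Rightarrow> real) set" where
  "kernel_span A K = {(\<lambda>y. \<Sum>x\<in>F. c x * K x y) | F c. finite F \<and> F \<subseteq> A}"

definition kernel_space :: "'a measure \<Rightarrow> 'b measure \<Rightarrow> ('a \<Rightarrow> 'b \<Rightarrow> real) \<Rightarrow> real \<Rightarrow> ('b \<Rightarrow> real) set" where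
  "kernel_space M N K q = {f \<in> Lq_space q N.
     \<forall>\<epsilon>>0. \<exists>g\<in>kernel_span (space M) K. Lq_norm q N (\<lambda>y. f y - g y) < \<epsilon>}"

definition discrepancy ::
  "'a measure \<Rightarrow> 'b measure \<Rightarrow> ('a \<Rightarrow> 'b \<Rightarrow> real) \<Rightarrow> real \<Rightarrow> nat \<Rightarrow> (nat \<Rightarrow> 'a) \<Rightarrow> real" where
  "discrepancy M N K q m \<xi> =
     Lq_norm q N (\<lambda>y. kernel_integral M K y - (1 / real m) * (\<Sum>\<mu>=1..m. K (\<xi> \<mu>) y))"

end

theory Submission
  imports Defs
begin

text \<open>The points are chosen greedily. Let \<open>J\<close> be the kernel integral and
  \<open>f\<close> the sum of \<open>J - K \<xi>\<^sub>\<mu>\<close> over the first \<open>n\<close> points. By Fubini, the pairing of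
  \<open>sgn f * \<bar>f\<bar> powr (q - 1)\<close> with \<open>J - K x\<close> has mean \<open>0\<close> over \<open>x\<close>, so the next point
  \<open>x\<close> can be chosen with nonpositive pairing. The second-order Taylor estimate of
  \<open>\<bar>f + (J - K x)\<bar> powr q\<close> then bounds the increment of the \<open>q\<close>-th power \<open>r powr q\<close> of the
  norm of \<open>f\<close> by \<open>4 * q\<^sup>2 * (r + 2) powr (q - 2)\<close>, because \<open>J - K x\<close> has norm at most \<open>2\<close>.
  This recursion keeps the norm below \<open>4 * sqrt (q * n)\<close>, which gives the constant \<open>C = 4\<close>.\<close>

section \<open>Scalar inequalities for real powers\<close>

lemma powr_diff_2_mult_square:
  fixes x q :: real
  assumes "x > 0"
  shows "x powr (q - 2) * x\<^sup>2 = x powr q"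
  using assms powr_add[of x "q - 2" 2] by simp

text \<open>For \<open>a + b > 0\<close> this is Taylor's formula with Lagrange remainder, whose
  intermediate point is at most \<open>a + \<bar>b\<bar>\<close>. Otherwise the segment from
  \<open>a\<close> to \<open>a + b\<close> reaches 0 and the formula fails, but then
  \<open>\<bar>b\<bar> \<ge> a\<close>, and the last term alone absorbs both the left-hand side and
  the negative linear term.\<close>

lemma powr_add_le_taylor_pos:
  fixes a b q :: real
  assumes "q \<ge> 2" "a > 0"
  shows "\<bar>a + b\<bar> powr q \<le> a powr q + q * a powr (q - 1) * b + q\<^sup>2 * (a + \<bar>b\<bar>) powr (q - 2) * b\<^sup>2"
proof (cases "b = 0")
  case True
  then show ?thesis using assms by simp
next
  case b: False
  show ?thesis
  proof (cases "a + b > 0")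
    case True
    define diff where "diff = (\<lambda>m::nat. \<lambda>t. if m = 0 then t powr q else if m = 1 then q * t powr (q - 1)
                          else q * ((q - 1) * t powr (q - 2)))"
    have "\<exists>t. (if a + b < a then a + b < t \<and> t < a else a < t \<and> t < a + b) \<and>
      (a + b) powr q = (\<Sum>m<2. (diff m a / fact m) * (a + b - a)^m) + (diff 2 t / fact 2) * (a + b - a)^2"
    proof (rule Taylor)
      show "\<forall>m t. m < 2 \<and> min a (a + b) \<le> t \<and> t \<le> max a (a + b) \<longrightarrow> DERIV (diff m) t :> diff (Suc m) t"
      proof (intro allI impI)
        fix m :: nat and t :: real
        assume *: "m < 2 \<and> min a (a + b) \<le> t \<and> t \<le> max a (a + b)"
        then have t: "t > 0" using True assms by (auto simp: min_def split: if_splits)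
        from * consider "m = 0" | "m = 1" by linarith
        then show "DERIV (diff m) t :> diff (Suc m) t"
          using t by cases (auto simp: diff_def intro!: derivative_eq_intros)
      qed
    qed (use b in \<open>auto simp: diff_def\<close>)
    then obtain t where t: "if a + b < a then a + b < t \<and> t < a else a < t \<and> t < a + b"
      and eq: "(a + b) powr q = a powr q + q * a powr (q - 1) * b + q * ((q - 1) * t powr (q - 2)) / 2 * b\<^sup>2"
      by (auto simp: diff_def numeral_2_eq_2)
    have "0 \<le> t" "t \<le> a + \<bar>b\<bar>" using t True assms by (auto split: if_splits)
    then have "t powr (q - 2) \<le> (a + \<bar>b\<bar>) powr (q - 2)"
      using assms by (intro powr_mono2) auto
    then have "q * ((q - 1) * t powr (q - 2)) / 2 \<le> q\<^sup>2 * (a + \<bar>b\<bar>) powr (q - 2)"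
    proof -
      have "q * (q - 1) / 2 \<le> q\<^sup>2" using assms by (simp add: power2_eq_square right_diff_distrib) (smt (verit) mult_nonneg_nonneg)
      moreover have "t powr (q - 2) \<le> (a + \<bar>b\<bar>) powr (q - 2)" by fact
      ultimately have "q * (q - 1) / 2 * t powr (q - 2) \<le> q\<^sup>2 * (a + \<bar>b\<bar>) powr (q - 2)"
        by (intro mult_mono) auto
      then show ?thesis by (simp add: mult.assoc)
    qed
    from mult_right_mono[OF this, of "b\<^sup>2"] show ?thesis using eq True by simp
  next
    case False
    then have ba: "a \<le> - b" by simp
    define c where "c = - b"
    have c: "a \<le> c" "c > 0" "b = - c" using ba assms by (auto simp: c_def)
    have "(c - a) powr q \<le> c powr q" using c assms by (intro powr_mono2) auto
    also have "c powr q = c powr (q - 2) * c\<^sup>2"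
      using c by (simp add: powr_diff_2_mult_square)
    also have "\<dots> \<le> (a + c) powr (q - 2) * c\<^sup>2"
      using c assms by (intro mult_right_mono powr_mono2) auto
    finally have 1: "(c - a) powr q \<le> (a + c) powr (q - 2) * c\<^sup>2" .
    have "a powr (q - 1) * c = a powr (q - 2) * (a * c)"
      using assms powr_add[of a "q - 2" 1] by simp
    also have "\<dots> \<le> (a + c) powr (q - 2) * c\<^sup>2"
      using c assms by (intro mult_mono powr_mono2) (auto simp: power2_eq_square)
    finally have 2: "a powr (q - 1) * c \<le> (a + c) powr (q - 2) * c\<^sup>2" .
    have 3: "q * (a powr (q - 1) * c) \<le> q * ((a + c) powr (q - 2) * c\<^sup>2)"
      using 2 assms by (intro mult_left_mono) auto
    have "(c - a) powr q + q * (a powr (q - 1) * c) \<le> (1 + q) * ((a + c) powr (q - 2) * c\<^sup>2)"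
      using 1 3 by (simp add: distrib_right)
    also have "\<dots> \<le> q\<^sup>2 * ((a + c) powr (q - 2) * c\<^sup>2)"
    \<comment> \<open>This case uses the room in the factor \<open>q\<^sup>2\<close>: the Taylor
      coefficient \<open>q * (q - 1) / 2\<close> would be 1 at \<open>q = 2\<close>, where
      \<open>1 + q\<close> is 3.\<close>
    proof (rule mult_right_mono)
      have "2 * q \<le> q * q" using assms by (intro mult_right_mono) auto
      then show "1 + q \<le> q\<^sup>2" unfolding power2_eq_square using assms by linarith
    qed simp
    also have "\<dots> \<le> a powr q + q\<^sup>2 * ((a + c) powr (q - 2) * c\<^sup>2)" by simp
    finally have "(c - a) powr q + q * (a powr (q - 1) * c)
      \<le> a powr q + q\<^sup>2 * ((a + c) powr (q - 2) * c\<^sup>2)" .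
    moreover have "\<bar>a + b\<bar> = c - a" "\<bar>b\<bar> = c" "b\<^sup>2 = c\<^sup>2" using c by auto
    ultimately show ?thesis using c(3) by (simp add: mult.assoc)
  qed
qed

lemma abs_add_powr_le_taylor:
  fixes a b q :: real
  assumes "q \<ge> 2"
  shows "\<bar>a + b\<bar> powr q \<le> \<bar>a\<bar> powr q + q * (sgn a * \<bar>a\<bar> powr (q - 1) * b)
           + q\<^sup>2 * ((\<bar>a\<bar> + \<bar>b\<bar>) powr (q - 2) * b\<^sup>2)"
proof -
  consider "a > 0" | "a < 0" | "a = 0" by linarith
  then show ?thesis
  proof cases
    case 1
    with powr_add_le_taylor_pos[OF assms 1, of b] show ?thesis by (simp add: algebra_simps)
  next
    case 2
    have "\<bar>- a + - b\<bar> = \<bar>a + b\<bar>" by simp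
    with 2 powr_add_le_taylor_pos[OF assms, of "- a" "- b"] show ?thesis by (simp add: algebra_simps)
  next
    \<comment> \<open>Since \<open>sgn 0 = 0\<close>, only the last term survives, and it equals
      \<open>q\<^sup>2 * \<bar>b\<bar> powr q\<close>.\<close>
    case 3
    have "1 * 1 \<le> q\<^sup>2" using assms by simp
    moreover have "\<bar>b\<bar> powr q = \<bar>b\<bar> powr (q - 2) * b\<^sup>2" 
      using powr_diff_2_mult_square[of "\<bar>b\<bar>" q] by (cases "b = 0") auto
    ultimately show ?thesis using 3 
      by (simp add: mult_right_mono[of 1 "q\<^sup>2" "\<bar>b\<bar> powr (q - 2) * b\<^sup>2", simplified])
  qed
qed

text \<open>Convexity on the open half-line settles positive \<open>x\<close> and \<open>y\<close>.
  If one of them is 0, what remains is \<open>r powr q \<le> r\<close> for \<open>r\<close> between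
  0 and 1.\<close>

lemma convex_comb_powr_le:
  fixes x y s t q :: real
  assumes "q \<ge> 1" "x \<ge> 0" "y \<ge> 0" "s \<ge> 0" "t \<ge> 0" "s + t = 1"
  shows "(s * x + t * y) powr q \<le> s * x powr q + t * y powr q"
proof -
  have *: "(r * z) powr q \<le> r * z powr q" if "0 \<le> r" "r \<le> 1" "z \<ge> 0" for r z :: real
  proof -
    have "r powr q \<le> r powr 1" if "r > 0" using that assms(1) \<open>r \<le> 1\<close> by (intro powr_mono') auto
    then have "r powr q \<le> r" using \<open>r \<ge> 0\<close> by (cases "r = 0") auto
    then show ?thesis using that by (simp add: powr_mult mult_right_mono)
  qed
  show ?thesis
  proof (cases "x = 0 \<or> y = 0")
    case True
    then show ?thesis using *[of s x] *[of t y] assms by auto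
  next
    case False
    then show ?thesis
      using convex_onD[OF powr_convex[OF assms(1)], of t x y] assms
      by (auto simp: \<open>s + t = 1\<close>[THEN eq_diff_eq[THEN iffD2]])
  qed
qed

text \<open>Pointwise form of Minkowski's inequality: \<open>(a + b) / (R + T)\<close> is the convex
  combination of \<open>a / R\<close> and \<open>b / T\<close> with weights
  \<open>R / (R + T)\<close> and \<open>T / (R + T)\<close>.\<close>

lemma add_powr_le_convex:
  fixes a b R T q :: real
  assumes "q \<ge> 1" "a \<ge> 0" "b \<ge> 0" "R > 0" "T > 0"
  shows "(a + b) powr q \<le> (R + T) powr q * (R / (R + T) * (a powr q / R powr q) + T / (R + T) * (b powr q / T powr q))"
proof -
  have "a + b = (R + T) * (R / (R + T) * (a / R) + T / (R + T) * (b / T))"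
  proof -
    have "R / (R + T) * (a / R) + T / (R + T) * (b / T) = (a + b) / (R + T)"
      using assms by (simp add: add_divide_distrib)
    then show ?thesis using assms by simp
  qed
  then have "(a + b) powr q = (R + T) powr q * (R / (R + T) * (a / R) + T / (R + T) * (b / T)) powr q"
    by (metis powr_mult)
  also have "\<dots> \<le> (R + T) powr q * (R / (R + T) * (a / R) powr q + T / (R + T) * (b / T) powr q)"
    using assms by (intro mult_left_mono convex_comb_powr_le) (auto simp flip: add_divide_distrib)
  finally show ?thesis using assms by (simp add: powr_divide)
qed

text \<open>Pointwise form of Hoelder's inequality with weights \<open>(q - 2) / q\<close> and
  \<open>2 / q\<close>, normalised by the intended norm bounds \<open>S\<close> and
  \<open>T\<close>. The assumption \<open>v \<le> u\<close> makes \<open>u\<close> positive as soon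
  as \<open>v\<close> is.\<close>

lemma powr_mult_square_le_Young:
  fixes u v S T q :: real
  assumes "q \<ge> 2" "0 \<le> v" "v \<le> u" "S > 0" "T > 0"
  shows "u powr (q - 2) * v\<^sup>2 \<le> S powr (q - 2) * T\<^sup>2 *
           ((q - 2) / q * (u powr q / S powr q) + 2 / q * (v powr q / T powr q))"
proof (cases "v = 0")
  case True
  then show ?thesis using assms by simp
next
  case False
  then have v: "v > 0" "u > 0" using assms by auto
  have "((u / S) powr q) powr ((q - 2) / q) * ((v / T) powr q) powr (2 / q)
      \<le> (q - 2) / q * (u / S) powr q + 2 / q * (v / T) powr q"
    using assms v by (intro Youngs_inequality_0) (auto simp: field_simps)
  then have "(u / S) powr (q - 2) * (v / T) powr 2 \<le> (q - 2) / q * (u / S) powr q + 2 / q * (v / T) powr q"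
    using assms by (simp add: powr_powr)
  then have "S powr (q - 2) * T\<^sup>2 * ((u / S) powr (q - 2) * (v / T) powr 2)
     \<le> S powr (q - 2) * T\<^sup>2 * ((q - 2) / q * (u / S) powr q + 2 / q * (v / T) powr q)"
    by (intro mult_left_mono) auto
  moreover have "S powr (q - 2) * T\<^sup>2 * ((u / S) powr (q - 2) * (v / T) powr 2) = u powr (q - 2) * v\<^sup>2"
    using assms v by (simp add: powr_divide power_divide)
  ultimately show ?thesis using assms v by (simp add: powr_divide)
qed

text \<open>Young's inequality for the conjugate exponents \<open>q / (q - 1)\<close> and
  \<open>q\<close>.\<close>

lemma abs_sgn_powr_mult_le_Young:
  fixes a b q :: real
  assumes "q \<ge> 2"
  shows "\<bar>sgn a * \<bar>a\<bar> powr (q - 1) * b\<bar> \<le> (1 - 1 / q) * \<bar>a\<bar> powr q + 1 / q * \<bar>b\<bar> powr q"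
proof (cases "a = 0 \<or> b = 0")
  case True
  then show ?thesis using assms by auto
next
  case False
  have "(\<bar>a\<bar> powr q) powr (1 - 1 / q) * (\<bar>b\<bar> powr q) powr (1 / q)
      \<le> (1 - 1 / q) * \<bar>a\<bar> powr q + 1 / q * \<bar>b\<bar> powr q"
    using assms False by (intro Youngs_inequality_0) (auto simp: field_simps)
  moreover have "(\<bar>a\<bar> powr q) powr (1 - 1 / q) = \<bar>a\<bar> powr (q - 1)"
    using assms by (simp add: powr_powr right_diff_distrib)
  ultimately show ?thesis using assms False by (simp add: powr_powr abs_mult)
qed

text \<open>Bernoulli's inequality, read off from weighted AM-GM: the numbers
  \<open>1 + p * x\<close> and 1 with weights \<open>1 / p\<close> and \<open>1 - 1 / p\<close> have
  arithmetic mean \<open>1 + x\<close>.\<close>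

lemma one_plus_mult_le_powr:
  fixes p x :: real
  assumes "p \<ge> 1" "x \<ge> 0"
  shows "1 + p * x \<le> (1 + x) powr p"
proof -
  have "(1 + p * x) powr (1 / p) * 1 powr (1 - 1 / p) \<le> 1 / p * (1 + p * x) + (1 - 1 / p) * 1"
    using assms by (intro Youngs_inequality_0) (auto intro: add_pos_nonneg)
  also have "\<dots> = 1 + x" using assms by (simp add: field_simps)
  finally have "((1 + p * x) powr (1 / p)) powr p \<le> (1 + x) powr p"
    using assms by (intro powr_mono2) auto
  then show ?thesis using assms by (simp add: powr_powr add_pos_nonneg)
qed

text \<open>The constant 4 is fixed here. Up to a factor 2, \<open>R + 2\<close> may be replaced by
  \<open>R\<close>, so the increment is at most \<open>8 * q\<^sup>2 * R powr (q - 2)\<close>. As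
  \<open>R\<^sup>2 = 16 * q * n\<close>, this is \<open>R powr q\<close> times
  \<open>q / (2 * n)\<close>, and Bernoulli's inequality with exponent \<open>q / 2\<close> yields
  exactly the growth from \<open>n\<close> to \<open>n + 1\<close>.\<close>

lemma four_sqrt_powr_step:
  fixes q n R :: real
  assumes q: "q \<ge> 2" and n: "n \<ge> q" and R: "R = 4 * sqrt (q * n)"
  shows "R powr q + q\<^sup>2 * ((R + 2) powr (q - 2) * 2\<^sup>2) \<le> (4 * sqrt (q * (n + 1))) powr q"
proof -
  have Rq: "R \<ge> 4 * q"
    using real_sqrt_le_mono[of "q * q" "q * n"] q n by (simp add: R)
  then have R0: "R > 0" using q by linarith
  have R2: "R\<^sup>2 = 16 * q * n" using q n by (simp add: R power_mult_distrib)
  have "(1 + 2 / R) powr (q - 2) \<le> exp (2 / R) powr (q - 2)"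
    using q R0 by (intro powr_mono2) auto
  also have "\<dots> = exp (2 / R * (q - 2))" by (simp add: exp_powr_real)
  \<comment> \<open>The assumption \<open>n \<ge> q\<close> enters through
    \<open>R \<ge> 4 * q\<close>, which keeps the exponent below \<open>1 / 2\<close> for every
    \<open>q\<close>.\<close>
  also have "\<dots> \<le> exp (1 / 2)" using q Rq R0 by (simp add: field_simps)
  also have "\<dots> \<le> 2" using exp_bound[of "1 / 2::real"] by (simp add: power2_eq_square)
  finally have e: "(1 + 2 / R) powr (q - 2) \<le> 2" .
  have "R + 2 = R * (1 + 2 / R)" using R0 by (simp add: distrib_left)
  then have "(R + 2) powr (q - 2) = R powr (q - 2) * (1 + 2 / R) powr (q - 2)"
    by (metis powr_mult)
  also have "\<dots> \<le> R powr (q - 2) * 2" using e by (intro mult_left_mono) auto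
  finally have 1: "(R + 2) powr (q - 2) \<le> R powr (q - 2) * 2" .
  have "R powr q + q\<^sup>2 * ((R + 2) powr (q - 2) * 2\<^sup>2) \<le> R powr q + q\<^sup>2 * ((R powr (q - 2) * 2) * 2\<^sup>2)"
    using 1 by (intro add_left_mono mult_left_mono mult_right_mono) auto
  also have "\<dots> = R powr (q - 2) * (R\<^sup>2 + 8 * q\<^sup>2)"
    using powr_diff_2_mult_square[OF R0, of q] by (simp add: distrib_left)
  also have "\<dots> = R powr (q - 2) * (R\<^sup>2 * (1 + q / 2 * (1 / n)))"
  proof -
    have "R\<^sup>2 * (1 + q / 2 * (1 / n)) = R\<^sup>2 + 8 * q\<^sup>2"
      unfolding R2 using q n by (simp add: field_simps power2_eq_square)
    then show ?thesis by simp
  qed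
  also have "\<dots> = R powr q * (1 + q / 2 * (1 / n))"
    using powr_diff_2_mult_square[OF R0, of q] by (simp flip: mult.assoc)
  also have "\<dots> \<le> R powr q * (1 + 1 / n) powr (q / 2)"
    using q n by (intro mult_left_mono one_plus_mult_le_powr) auto
  also have "\<dots> = R powr q * (sqrt (1 + 1 / n)) powr q"
    using q n by (simp add: powr_half_sqrt[symmetric] powr_powr)
  also have "\<dots> = (4 * sqrt (q * (n + 1))) powr q"
  proof -
    have "R * sqrt (1 + 1 / n) = 4 * sqrt (q * (n + 1))"
      using q n by (simp add: R distrib_left flip: real_sqrt_mult)
    then show ?thesis by (metis powr_mult)
  qed
  finally show ?thesis .
qed

section \<open>Averaging over the first variable\<close>

text \<open>By Fubini the pairing of \<open>G\<close> with the kernel integral is the mean over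
  \<open>x\<close> of its pairings with \<open>K x\<close>, and these cannot all lie strictly below
  their mean. The uniform bound \<open>B\<close> secures the integrability for Fubini.\<close>

lemma ex_kernel_integral_le:
  fixes M :: "'a measure" and N :: "'b measure" and G :: "'b \<Rightarrow> real" and K :: "'a \<Rightarrow> 'b \<Rightarrow> real"
  assumes M1: "emeasure M (space M) = 1" and N: "sigma_finite_measure N"
    and K: "(\<lambda>(x, y). K x y) \<in> borel_measurable (completion (M \<Otimes>\<^sub>M N))"
    and Kx: "\<And>x. x \<in> space M \<Longrightarrow> K x \<in> borel_measurable N"
    and Ky: "\<And>y. y \<in> space N \<Longrightarrow> integrable M (\<lambda>x. K x y)"
    and J[measurable]: "kernel_integral M K \<in> borel_measurable N"
    and G[measurable]: "G \<in> borel_measurable N"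
    and GK: "\<And>x. x \<in> space M \<Longrightarrow> integrable N (\<lambda>y. G y * K x y)"
    and B: "\<And>x. x \<in> space M \<Longrightarrow> (\<integral>y. \<bar>G y * K x y\<bar> \<partial>N) \<le> B"
  obtains x where "x \<in> space M" "(\<integral>y. G y * kernel_integral M K y \<partial>N) \<le> (\<integral>y. G y * K x y \<partial>N)"
proof (rule ccontr)
  assume "\<not> thesis"
  with that have neg: "(\<integral>y. G y * K x y \<partial>N) < (\<integral>y. G y * kernel_integral M K y \<partial>N)" if "x \<in> space M" for x
    using \<open>x \<in> space M\<close> by (meson not_le)
  interpret M: finite_measure M by standard (simp add: M1)
  interpret N: sigma_finite_measure N by fact
  interpret P: pair_sigma_finite M N ..
  interpret Q: pair_sigma_finite N M ..
  \<comment> \<open>Fubini is applied on the uncompleted product, so \<open>K\<close> is replaced by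
    a version \<open>k\<close> measurable there and equal to \<open>K\<close> off a null set
    \<open>Z\<close>. Almost all sections of \<open>Z\<close> are null in both directions: those at
    fixed \<open>x\<close> preserve the pairings, those at fixed \<open>y\<close> the kernel
    integral.\<close>
  obtain k where k: "k \<in> borel_measurable (M \<Otimes>\<^sub>M N)" and "AE p in M \<Otimes>\<^sub>M N. (\<lambda>(x, y). K x y) p = k p"
    using completion_ex_borel_measurable_real[OF K] by blast
  then obtain Z where Z[measurable]: "Z \<in> sets (M \<Otimes>\<^sub>M N)" and Z0: "emeasure (M \<Otimes>\<^sub>M N) Z = 0"
    and Zk: "{p \<in> space (M \<Otimes>\<^sub>M N). (\<lambda>(x, y). K x y) p \<noteq> k p} \<subseteq> Z"
    by (auto elim: AE_E)
  define k' where "k' = (\<lambda>x y. k (x, y))"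
  have [measurable]: "(\<lambda>p. k' (fst p) (snd p)) \<in> borel_measurable (M \<Otimes>\<^sub>M N)" using k by (simp add: k'_def)
  have k'x: "k' x \<in> borel_measurable N" if "x \<in> space M" for x
    using that k unfolding k'_def by (intro measurable_Pair2)
  have k'y: "(\<lambda>x. k' x y) \<in> borel_measurable M" if "y \<in> space N" for y
    using that k unfolding k'_def by (intro measurable_Pair1)
  have eq: "K x y = k' x y" if "x \<in> space M" "y \<in> space N" "(x, y) \<notin> Z" for x y
    using that Zk by (auto simp: space_pair_measure k'_def)
  have "AE p in M \<Otimes>\<^sub>M N. p \<notin> Z" using Z Z0 by (intro AE_not_in) (simp add: null_sets_def)
  then have AE1: "AE x in M. AE y in N. (x, y) \<notin> Z" by (rule P.AE_pair)
  moreover have "(AE x in M. AE y in N. (x, y) \<notin> Z) \<longleftrightarrow> (AE y in N. AE x in M. (x, y) \<notin> Z)"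
    by (rule P.AE_commute) simp
  ultimately have AE2: "AE y in N. AE x in M. (x, y) \<notin> Z" by simp
  have AEx: "AE x in M. x \<in> space M \<and> (AE y in N. G y * K x y = G y * k' x y)"
    using AE1 AE_space by eventually_elim (auto elim!: eventually_mono[OF eventually_conj[OF _ AE_space]] simp: eq)
  have AEx': "AE x in M. integrable N (\<lambda>y. G y * k' x y) \<and> (\<integral>y. \<bar>G y * k' x y\<bar> \<partial>N) \<le> B \<and>
     (\<integral>y. G y * k' x y \<partial>N) < (\<integral>y. G y * kernel_integral M K y \<partial>N)"
    using AEx
  proof eventually_elim
    case (elim x)
    have [measurable]: "K x \<in> borel_measurable N" "k' x \<in> borel_measurable N" using elim Kx k'x by auto
    have "integrable N (\<lambda>y. G y * k' x y)"
      using elim GK[of x] by (subst integrable_cong_AE[symmetric]) auto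
    moreover have "(\<integral>y. G y * k' x y \<partial>N) = (\<integral>y. G y * K x y \<partial>N)"
      "(\<integral>y. \<bar>G y * k' x y\<bar> \<partial>N) = (\<integral>y. \<bar>G y * K x y\<bar> \<partial>N)"
      using elim by (auto intro!: integral_cong_AE)
    ultimately show ?case using B[of x] neg[of x] elim by auto
  qed
  \<comment> \<open>The inner integrals of the absolute value are bounded by \<open>B\<close> for
    almost every \<open>x\<close>, hence integrable over the finite measure
    \<open>M\<close>.\<close>
  have int: "integrable (M \<Otimes>\<^sub>M N) (\<lambda>p. G (snd p) * k' (fst p) (snd p))"
  proof (rule P.Fubini_integrable)
    show "integrable M (\<lambda>x. \<integral>y. norm (G (snd (x, y)) * k' (fst (x, y)) (snd (x, y))) \<partial>N)"
      using AEx' by (intro M.integrable_const_bound[where B = B]) (auto elim!: eventually_mono)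
  qed (use AEx' in \<open>auto elim!: eventually_mono\<close>)
  then have int': "integrable (M \<Otimes>\<^sub>M N) (case_prod (\<lambda>x y. G y * k' x y))"
    by (simp add: case_prod_unfold)
  have "(\<integral>y. G y * kernel_integral M K y \<partial>N) = (\<integral>y. (\<integral>x. G y * k' x y \<partial>M) \<partial>N)"
  proof (rule integral_cong_AE)
    show "AE y in N. G y * kernel_integral M K y = (\<integral>x. G y * k' x y \<partial>M)"
      using AE2 AE_space
    proof eventually_elim
      case (elim y)
      then have "kernel_integral M K y = (\<integral>x. k' x y \<partial>M)"
        unfolding kernel_integral_def using Ky k'y
        by (intro integral_cong_AE) (auto elim!: eventually_mono[OF eventually_conj[OF _ AE_space]] simp: eq)
      then show ?case by simp
    qed
    show "(\<lambda>y. \<integral>x. G y * k' x y \<partial>M) \<in> borel_measurable N"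
      using Q.integrable_fst'[of "\<lambda>(y, x). G y * k' x y"] P.integrable_product_swap[OF int']
      by (auto dest: borel_measurable_integrable)
  qed simp
  also have "\<dots> = (\<integral>x. (\<integral>y. G y * k' x y \<partial>N) \<partial>M)"
    by (rule P.Fubini_integral[OF int'])
  \<comment> \<open>Strictness almost everywhere survives integration because \<open>M\<close> has
    positive mass.\<close>
  also have "\<dots> < (\<integral>x. (\<integral>y. G y * kernel_integral M K y \<partial>N) \<partial>M)"
    using AEx' P.integrable_fst[OF int']
    by (intro M.integral_less_AE_space) (auto simp: M1 elim!: eventually_mono)
  finally show False by (simp add: measure_def M1)
qed

section \<open>Triangle inequality, duality and smoothness in \<open>Lq_space\<close>\<close>

text \<open>Integrating \<open>add_powr_le_convex\<close> gives Minkowski's inequality. Working with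
  positive upper bounds \<open>R\<close> and \<open>T\<close> instead of the norms avoids division
  by a vanishing norm. The version with \<open>\<bar>f y\<bar> + \<bar>g y\<bar>\<close> controls
  the second-order term in \<open>Lq_smoothness\<close>.\<close>

lemma Lq_add:
  fixes f g :: "'b \<Rightarrow> real"
  assumes "q \<ge> 1" "R > 0" "T > 0"
    and f: "f \<in> Lq_space q N" "(\<integral>y. \<bar>f y\<bar> powr q \<partial>N) \<le> R powr q"
    and g: "g \<in> Lq_space q N" "(\<integral>y. \<bar>g y\<bar> powr q \<partial>N) \<le> T powr q"
  shows "integrable N (\<lambda>y. (\<bar>f y\<bar> + \<bar>g y\<bar>) powr q)"
    and "(\<integral>y. (\<bar>f y\<bar> + \<bar>g y\<bar>) powr q \<partial>N) \<le> (R + T) powr q"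
    and "(\<lambda>y. f y + g y) \<in> Lq_space q N"
    and "(\<integral>y. \<bar>f y + g y\<bar> powr q \<partial>N) \<le> (R + T) powr q"
proof -
  have [measurable]: "f \<in> borel_measurable N" "g \<in> borel_measurable N"
    and int: "integrable N (\<lambda>y. \<bar>f y\<bar> powr q)" "integrable N (\<lambda>y. \<bar>g y\<bar> powr q)"
    using f g by (auto simp: Lq_space_def)
  let ?h = "\<lambda>y. (R + T) powr q * (R / (R + T) * (\<bar>f y\<bar> powr q / R powr q) + T / (R + T) * (\<bar>g y\<bar> powr q / T powr q))"
  have le: "(\<bar>f y\<bar> + \<bar>g y\<bar>) powr q \<le> ?h y" for y
    using assms by (intro add_powr_le_convex) auto
  have h: "integrable N ?h" using int by simp
  show 1: "integrable N (\<lambda>y. (\<bar>f y\<bar> + \<bar>g y\<bar>) powr q)"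
  proof (rule Bochner_Integration.integrable_bound[OF h])
    show "AE y in N. norm ((\<bar>f y\<bar> + \<bar>g y\<bar>) powr q) \<le> norm (?h y)"
      using order.trans[OF le abs_ge_self] by (intro AE_I2) (simp only: real_norm_def abs_of_nonneg powr_ge_zero)
  qed simp
  have "(\<integral>y. (\<bar>f y\<bar> + \<bar>g y\<bar>) powr q \<partial>N) \<le> (\<integral>y. ?h y \<partial>N)"
    by (rule integral_mono[OF 1 h]) (rule le)
  also have "\<dots> = (R + T) powr q * (R / (R + T) * ((\<integral>y. \<bar>f y\<bar> powr q \<partial>N) / R powr q)
                     + T / (R + T) * ((\<integral>y. \<bar>g y\<bar> powr q \<partial>N) / T powr q))"
    using int by simp
  also have "\<dots> \<le> (R + T) powr q * (R / (R + T) * 1 + T / (R + T) * 1)"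
    using assms by (intro mult_left_mono add_mono) auto
  also have "\<dots> = (R + T) powr q" using assms by (simp flip: add_divide_distrib)
  finally show 2: "(\<integral>y. (\<bar>f y\<bar> + \<bar>g y\<bar>) powr q \<partial>N) \<le> (R + T) powr q" .
  have le': "\<bar>f y + g y\<bar> powr q \<le> (\<bar>f y\<bar> + \<bar>g y\<bar>) powr q" for y
    using assms by (intro powr_mono2) auto
  have 3: "integrable N (\<lambda>y. \<bar>f y + g y\<bar> powr q)"
    by (rule Bochner_Integration.integrable_bound[OF 1]) (use le' in auto)
  then show "(\<lambda>y. f y + g y) \<in> Lq_space q N" by (simp add: Lq_space_def)
  show "(\<integral>y. \<bar>f y + g y\<bar> powr q \<partial>N) \<le> (R + T) powr q"
    using integral_mono[OF 3 1 le'] 2 by simp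
qed

text \<open>Up to the factor \<open>q\<close>, the pairing is the derivative of the integral of
  \<open>\<bar>f y\<bar> powr q\<close> in direction \<open>g\<close>. The additive bound from
  Young's inequality replaces Hoelder's.\<close>

lemma Lq_duality:
  fixes f g :: "'b \<Rightarrow> real"
  assumes "q \<ge> 2" and f: "f \<in> Lq_space q N" and g: "g \<in> Lq_space q N"
  shows "integrable N (\<lambda>y. sgn (f y) * \<bar>f y\<bar> powr (q - 1) * g y)"
    and "(\<integral>y. \<bar>sgn (f y) * \<bar>f y\<bar> powr (q - 1) * g y\<bar> \<partial>N)
           \<le> (1 - 1 / q) * (\<integral>y. \<bar>f y\<bar> powr q \<partial>N) + 1 / q * (\<integral>y. \<bar>g y\<bar> powr q \<partial>N)"
proof -
  have [measurable]: "f \<in> borel_measurable N" "g \<in> borel_measurable N"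
    and int: "integrable N (\<lambda>y. \<bar>f y\<bar> powr q)" "integrable N (\<lambda>y. \<bar>g y\<bar> powr q)"
    using f g by (auto simp: Lq_space_def)
  have h: "integrable N (\<lambda>y. (1 - 1 / q) * \<bar>f y\<bar> powr q + 1 / q * \<bar>g y\<bar> powr q)"
    using int by simp
  note le = abs_sgn_powr_mult_le_Young[OF assms(1)]
  show 1: "integrable N (\<lambda>y. sgn (f y) * \<bar>f y\<bar> powr (q - 1) * g y)"
    by (rule Bochner_Integration.integrable_bound[OF h])
       (auto intro!: AE_I2 order.trans[OF le])
  have "(\<integral>y. \<bar>sgn (f y) * \<bar>f y\<bar> powr (q - 1) * g y\<bar> \<partial>N)
      \<le> (\<integral>y. (1 - 1 / q) * \<bar>f y\<bar> powr q + 1 / q * \<bar>g y\<bar> powr q \<partial>N)"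
    by (rule integral_mono[OF integrable_abs[OF 1] h]) (rule le)
  also have "\<dots> = (1 - 1 / q) * (\<integral>y. \<bar>f y\<bar> powr q \<partial>N) + 1 / q * (\<integral>y. \<bar>g y\<bar> powr q \<partial>N)"
    using int by simp
  finally show "(\<integral>y. \<bar>sgn (f y) * \<bar>f y\<bar> powr (q - 1) * g y\<bar> \<partial>N)
           \<le> (1 - 1 / q) * (\<integral>y. \<bar>f y\<bar> powr q \<partial>N) + 1 / q * (\<integral>y. \<bar>g y\<bar> powr q \<partial>N)" .
qed

text \<open>Integrated Taylor estimate. The remainder is handled by
  \<open>powr_mult_square_le_Young\<close> with \<open>u = \<bar>f y\<bar> + \<bar>g y\<bar>\<close>
  and \<open>S = R + T\<close>; after integration both normalised terms are at most 1 and the two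
  weights add up to 1.\<close>

lemma Lq_smoothness:
  fixes f g :: "'b \<Rightarrow> real"
  assumes "q \<ge> 2" "R > 0" "T > 0"
    and f: "f \<in> Lq_space q N" "(\<integral>y. \<bar>f y\<bar> powr q \<partial>N) \<le> R powr q"
    and g: "g \<in> Lq_space q N" "(\<integral>y. \<bar>g y\<bar> powr q \<partial>N) \<le> T powr q"
  shows "(\<integral>y. \<bar>f y + g y\<bar> powr q \<partial>N)
           \<le> R powr q + q * (\<integral>y. sgn (f y) * \<bar>f y\<bar> powr (q - 1) * g y \<partial>N)
              + q\<^sup>2 * ((R + T) powr (q - 2) * T\<^sup>2)"
proof -
  have q1: "q \<ge> 1" using assms by simp
  note add = Lq_add[OF q1 assms(2-)]
  have int: "integrable N (\<lambda>y. \<bar>f y\<bar> powr q)" "integrable N (\<lambda>y. \<bar>g y\<bar> powr q)"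
    "integrable N (\<lambda>y. \<bar>f y + g y\<bar> powr q)"
    using f g add(3) by (auto simp: Lq_space_def)
  note dual = Lq_duality(1)[OF assms(1) f(1) g(1)]
  let ?S = "R + T"
  let ?Y = "\<lambda>y. ?S powr (q - 2) * T\<^sup>2 *
    ((q - 2) / q * ((\<bar>f y\<bar> + \<bar>g y\<bar>) powr q / ?S powr q) + 2 / q * (\<bar>g y\<bar> powr q / T powr q))"
  let ?h = "\<lambda>y. \<bar>f y\<bar> powr q + q * (sgn (f y) * \<bar>f y\<bar> powr (q - 1) * g y) + q\<^sup>2 * ?Y y"
  have Y: "integrable N ?Y" using int add(1) by simp
  have le: "\<bar>f y + g y\<bar> powr q \<le> ?h y" for y
  proof -
    have "(\<bar>f y\<bar> + \<bar>g y\<bar>) powr (q - 2) * \<bar>g y\<bar>\<^sup>2 \<le> ?Y y"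
      using assms by (intro powr_mult_square_le_Young) auto
    then show ?thesis
      by (intro order.trans[OF abs_add_powr_le_taylor[OF assms(1)]] add_left_mono mult_left_mono) auto
  qed
  have "(\<integral>y. \<bar>f y + g y\<bar> powr q \<partial>N) \<le> (\<integral>y. ?h y \<partial>N)"
    using int dual Y le by (intro integral_mono) auto
  also have "\<dots> = (\<integral>y. \<bar>f y\<bar> powr q \<partial>N) + q * (\<integral>y. sgn (f y) * \<bar>f y\<bar> powr (q - 1) * g y \<partial>N)
      + q\<^sup>2 * (\<integral>y. ?Y y \<partial>N)"
    using int dual Y by simp
  also have "(\<integral>y. ?Y y \<partial>N) = ?S powr (q - 2) * T\<^sup>2 *
    ((q - 2) / q * ((\<integral>y. (\<bar>f y\<bar> + \<bar>g y\<bar>) powr q \<partial>N) / ?S powr q)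
      + 2 / q * ((\<integral>y. \<bar>g y\<bar> powr q \<partial>N) / T powr q))"
    using int add(1) by simp
  also have "\<dots> \<le> ?S powr (q - 2) * T\<^sup>2 * ((q - 2) / q * 1 + 2 / q * 1)"
    using assms add(2) by (intro mult_left_mono add_mono) auto
  also have "\<dots> = ?S powr (q - 2) * T\<^sup>2" using assms by (simp flip: add_divide_distrib)
  finally show ?thesis using f(2) by (simp add: mult_left_mono)
qed

section \<open>Greedy choice of the points\<close>

text \<open>Averaging with the duality functional of \<open>f\<close> as \<open>G\<close>. The bound
  of \<open>Lq_duality\<close> is uniform in \<open>x\<close> because all \<open>K x\<close> lie in
  the unit ball.\<close>

lemma kernel_greedy_step:
  assumes "emeasure M (space M) = 1" "sigma_finite_measure N" "q \<ge> 2"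
    and K: "K \<in> kernel_class M N q"
    and K1: "\<And>x. x \<in> space M \<Longrightarrow> (\<integral>y. \<bar>K x y\<bar> powr q \<partial>N) \<le> 1"
    and f: "f \<in> Lq_space q N"
  obtains x where "x \<in> space M"
    "(\<integral>y. sgn (f y) * \<bar>f y\<bar> powr (q - 1) * kernel_integral M K y \<partial>N)
       \<le> (\<integral>y. sgn (f y) * \<bar>f y\<bar> powr (q - 1) * K x y \<partial>N)"
proof (rule ex_kernel_integral_le[OF assms(1,2), where K = K and G = "\<lambda>y. sgn (f y) * \<bar>f y\<bar> powr (q - 1)"])
  have [measurable]: "f \<in> borel_measurable N" using f by (auto simp: Lq_space_def)
  show "(\<lambda>y. sgn (f y) * \<bar>f y\<bar> powr (q - 1)) \<in> borel_measurable N" by simp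
  fix x assume x: "x \<in> space M"
  then have Kx: "K x \<in> Lq_space q N" using K by (auto simp: kernel_class_def)
  show "integrable N (\<lambda>y. sgn (f y) * \<bar>f y\<bar> powr (q - 1) * K x y)"
    using Lq_duality(1)[OF assms(3) f Kx] .
  show "(\<integral>y. \<bar>sgn (f y) * \<bar>f y\<bar> powr (q - 1) * K x y\<bar> \<partial>N)
      \<le> (1 - 1 / q) * (\<integral>y. \<bar>f y\<bar> powr q \<partial>N) + 1 / q * 1"
    using assms K1[OF x]
    by (intro order.trans[OF Lq_duality(2)[OF assms(3) f Kx]] add_left_mono mult_left_mono) auto
qed (use K that in \<open>auto simp: kernel_class_def Lq_space_def\<close>)

text \<open>Duality replaces Minkowski's integral inequality: the greedy step applied to
  \<open>f = J\<close> gives \<open>I \<le> (1 - 1 / q) * I + 1 / q\<close> for \<open>I = \<integral> \<bar>J\<bar> powr q\<close>.\<close>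

lemma kernel_integral_Lq_le_1:
  assumes "emeasure M (space M) = 1" "sigma_finite_measure N" "q \<ge> 2"
    and K: "K \<in> kernel_class M N q"
    and K1: "\<And>x. x \<in> space M \<Longrightarrow> (\<integral>y. \<bar>K x y\<bar> powr q \<partial>N) \<le> 1"
  shows "(\<integral>y. \<bar>kernel_integral M K y\<bar> powr q \<partial>N) \<le> 1"
proof -
  let ?J = "kernel_integral M K"
  let ?I = "\<integral>y. \<bar>?J y\<bar> powr q \<partial>N"
  have J: "?J \<in> Lq_space q N" using K by (auto simp: kernel_class_def)
  obtain x where x: "x \<in> space M"
    and le: "(\<integral>y. sgn (?J y) * \<bar>?J y\<bar> powr (q - 1) * ?J y \<partial>N) \<le> (\<integral>y. sgn (?J y) * \<bar>?J y\<bar> powr (q - 1) * K x y \<partial>N)"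
    using kernel_greedy_step[OF assms J] by blast
  have Kx: "K x \<in> Lq_space q N" using x K by (auto simp: kernel_class_def)
  have "sgn t * \<bar>t\<bar> powr (q - 1) * t = \<bar>t\<bar> powr q" for t :: real
    using powr_add[of "\<bar>t\<bar>" "q - 1" 1] by (cases "t = 0") (auto simp: sgn_if)
  then have "?I = (\<integral>y. sgn (?J y) * \<bar>?J y\<bar> powr (q - 1) * ?J y \<partial>N)" by simp
  also note le
  also have "(\<integral>y. sgn (?J y) * \<bar>?J y\<bar> powr (q - 1) * K x y \<partial>N)
      \<le> (\<integral>y. \<bar>sgn (?J y) * \<bar>?J y\<bar> powr (q - 1) * K x y\<bar> \<partial>N)"
    using integral_abs_bound[of N "\<lambda>y. sgn (?J y) * \<bar>?J y\<bar> powr (q - 1) * K x y"] by linarith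
  also have "\<dots> \<le> (1 - 1 / q) * ?I + 1 / q * (\<integral>y. \<bar>K x y\<bar> powr q \<partial>N)"
    by (rule Lq_duality(2)[OF assms(3) J Kx])
  also have "\<dots> \<le> (1 - 1 / q) * ?I + 1 / q * 1"
    using K1[OF x] assms(3) by (intro add_left_mono mult_left_mono) auto
  finally show ?thesis using assms(3) by (simp add: field_simps)
qed

text \<open>Shows that the triangle inequality bound \<open>2 * m\<close> stays below the target as
  long as \<open>m \<le> 4 * q\<close>.\<close>

lemma two_mult_le_four_sqrt:
  fixes x q :: real
  assumes "0 \<le> x" "x \<le> 4 * q"
  shows "2 * x \<le> 4 * sqrt (q * x)"
proof -
  have "sqrt (x * x) \<le> sqrt (4 * q * x)"
    using assms by (intro real_sqrt_le_mono mult_right_mono) auto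
  then show ?thesis using assms by (simp add: real_sqrt_mult)
qed

text \<open>The recursion for the \<open>q\<close>-th powers yields the growth \<open>sqrt (q * m)\<close> only while the
  norm is at least of order \<open>q\<close>; for \<open>m \<le> 4 * q\<close> the triangle inequality already suffices.\<close>

lemma kernel_greedy_sequence:
  fixes M :: "'a measure" and N :: "'b measure"
  assumes "emeasure M (space M) = 1" "sigma_finite_measure N" "q \<ge> 2"
    and K: "K \<in> kernel_class M N q"
    and K1: "\<And>x. x \<in> space M \<Longrightarrow> (\<integral>y. \<bar>K x y\<bar> powr q \<partial>N) \<le> 1"
    and "m \<ge> 1"
  shows "\<exists>\<xi>. (\<forall>\<mu>\<in>{1..m}. \<xi> \<mu> \<in> space M) \<and>
     (\<lambda>y. \<Sum>\<mu>=1..m. kernel_integral M K y - K (\<xi> \<mu>) y) \<in> Lq_space q N \<and>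
     (\<integral>y. \<bar>\<Sum>\<mu>=1..m. kernel_integral M K y - K (\<xi> \<mu>) y\<bar> powr q \<partial>N)
        \<le> (if real m \<le> 4 * q then 2 * real m else 4 * sqrt (q * real m)) powr q"
  using \<open>m \<ge> 1\<close>
proof (induction m rule: dec_induct)
  let ?J = "kernel_integral M K"
  have q: "q \<ge> 1" using assms by simp
  have J: "?J \<in> Lq_space q N" using K by (auto simp: kernel_class_def)
  have J1: "(\<integral>y. \<bar>?J y\<bar> powr q \<partial>N) \<le> 1 powr q"
    using kernel_integral_Lq_le_1[OF assms(1-5)] by simp
  \<comment> \<open>Both terms have norm at most 1, which is the origin of the increment bound
    2.\<close>
  have diff: "(\<lambda>y. ?J y - K x y) \<in> Lq_space q N" "(\<integral>y. \<bar>?J y - K x y\<bar> powr q \<partial>N) \<le> 2 powr q"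
    if x: "x \<in> space M" for x
  proof -
    have Kx: "(\<lambda>y. - K x y) \<in> Lq_space q N" using x K by (auto simp: kernel_class_def Lq_space_def)
    have "(\<integral>y. \<bar>- K x y\<bar> powr q \<partial>N) \<le> 1 powr q" using K1[OF x] by simp
    from Lq_add(3,4)[OF q _ _ J J1 Kx this]
    show "(\<lambda>y. ?J y - K x y) \<in> Lq_space q N" "(\<integral>y. \<bar>?J y - K x y\<bar> powr q \<partial>N) \<le> 2 powr q"
      by auto
  qed
  {
    case base
    obtain x where "x \<in> space M" using kernel_greedy_step[OF assms(1-5) J] by blast
    then show ?case using diff[of x] assms(3) by (intro exI[of _ "\<lambda>_. x"]) auto
  next
    case (step n)
    then obtain \<xi> where \<xi>: "\<forall>\<mu>\<in>{1..n}. \<xi> \<mu> \<in> space M"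
      and *: "(\<lambda>y. \<Sum>\<mu>=1..n. ?J y - K (\<xi> \<mu>) y) \<in> Lq_space q N"
        "(\<integral>y. \<bar>\<Sum>\<mu>=1..n. ?J y - K (\<xi> \<mu>) y\<bar> powr q \<partial>N)
           \<le> (if real n \<le> 4 * q then 2 * real n else 4 * sqrt (q * real n)) powr q"
      by blast
    define f where "f = (\<lambda>y. \<Sum>\<mu>=1..n. ?J y - K (\<xi> \<mu>) y)"
    let ?R = "if real n \<le> 4 * q then 2 * real n else 4 * sqrt (q * real n)"
    have f: "f \<in> Lq_space q N" and fle: "(\<integral>y. \<bar>f y\<bar> powr q \<partial>N) \<le> ?R powr q"
      using * by (simp_all only: f_def)
    obtain x where x: "x \<in> space M"
      and le: "(\<integral>y. sgn (f y) * \<bar>f y\<bar> powr (q - 1) * ?J y \<partial>N) \<le> (\<integral>y. sgn (f y) * \<bar>f y\<bar> powr (q - 1) * K x y \<partial>N)"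
      using kernel_greedy_step[OF assms(1-5) f] by blast
    note g = diff[OF x]
    have Kx: "K x \<in> Lq_space q N" using x K by (auto simp: kernel_class_def)
    define \<xi>' where "\<xi>' = \<xi>(Suc n := x)"
    have sum: "(\<Sum>\<mu>=1..Suc n. ?J y - K (\<xi>' \<mu>) y) = f y + (?J y - K x y)" for y
    proof -
      have "(\<Sum>\<mu>=1..n. ?J y - K (\<xi>' \<mu>) y) = f y"
        unfolding f_def by (intro sum.cong) (auto simp: \<xi>'_def)
      then show ?thesis by (simp add: \<xi>'_def)
    qed
    have R: "?R > 0" using step assms(3) by (auto intro: mult_pos_pos)
    have in_space: "\<forall>\<mu>\<in>{1..Suc n}. \<xi>' \<mu> \<in> space M" using \<xi> x by (auto simp: \<xi>'_def le_Suc_eq)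
    note add = Lq_add(3,4)[OF q R _ f fle g]
    have "(\<integral>y. \<bar>f y + (?J y - K x y)\<bar> powr q \<partial>N)
        \<le> (if real (Suc n) \<le> 4 * q then 2 * real (Suc n) else 4 * sqrt (q * real (Suc n))) powr q"
    proof (cases "real (Suc n) \<le> 4 * q")
      case True
      \<comment> \<open>Here also \<open>n \<le> 4 * q\<close>, so the old bound is
        \<open>2 * n\<close> and the triangle inequality adds 2.\<close>
      then show ?thesis using add(2) by (simp add: algebra_simps)
    next
      case False
      let ?R' = "4 * sqrt (q * real n)"
      have n: "real n \<ge> q" "q * real n > 0" using False assms(3) step by auto
      \<comment> \<open>At the change of regime the old bound may still be the linear one; it is
        relaxed to \<open>?R'\<close> so that the recursion can start.\<close>
      have "2 * real n \<le> ?R'" if "real n \<le> 4 * q"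
        using that by (rule two_mult_le_four_sqrt[rotated]) simp
      then have "?R powr q \<le> ?R' powr q" using assms(3) by (intro powr_mono2) auto
      then have fle': "(\<integral>y. \<bar>f y\<bar> powr q \<partial>N) \<le> ?R' powr q" using fle by linarith
      \<comment> \<open>The choice of \<open>x\<close> makes the first-order term nonpositive,
        leaving only the second-order increment.\<close>
      have "(\<integral>y. sgn (f y) * \<bar>f y\<bar> powr (q - 1) * (?J y - K x y) \<partial>N) \<le> 0"
        using le Lq_duality(1)[OF assms(3) f J] Lq_duality(1)[OF assms(3) f Kx] by (simp add: right_diff_distrib)
      then have neg: "q * (\<integral>y. sgn (f y) * \<bar>f y\<bar> powr (q - 1) * (?J y - K x y) \<partial>N) \<le> 0"
        using assms(3) by (simp add: mult_le_0_iff)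
      have R': "?R' > 0" using n by simp
      have "(\<integral>y. \<bar>f y + (?J y - K x y)\<bar> powr q \<partial>N) \<le> ?R' powr q + q\<^sup>2 * ((?R' + 2) powr (q - 2) * 2\<^sup>2)"
        using Lq_smoothness[OF assms(3) R' _ f fle' g] neg by linarith
      also have "\<dots> \<le> (4 * sqrt (q * (real n + 1))) powr q"
        using four_sqrt_powr_step[OF assms(3) n(1) refl] .
      finally show ?thesis using False by (simp add: add.commute)
    qed
    with in_space add(1) show ?case
      by (intro exI[of _ \<xi>']) (simp only: sum simp_thms)
  }
qed

section \<open>From the greedy sums to the discrepancy\<close>

lemma discrepancy_greedy:
  fixes M :: "'a measure" and N :: "'b measure"
  assumes "emeasure M (space M) = 1" "sigma_finite_measure N" "q \<ge> 2"
    and K: "K \<in> kernel_class M N q"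
    and K1: "\<And>x. x \<in> space M \<Longrightarrow> Lq_norm q N (K x) \<le> 1"
    and m: "m \<ge> 1"
  shows "\<exists>\<xi>. (\<forall>\<mu>\<in>{1..m}. \<xi> \<mu> \<in> space M) \<and>
     discrepancy M N K q m \<xi> \<le> 4 * q powr (1 / 2) * real m powr (- 1 / 2)"
proof -
  let ?J = "kernel_integral M K"
  have "(\<integral>y. \<bar>K x y\<bar> powr q \<partial>N) \<le> 1" if "x \<in> space M" for x
  proof -
    have "(\<integral>y. \<bar>K x y\<bar> powr q \<partial>N) = (Lq_norm q N (K x)) powr q"
      using assms(3) by (simp add: Lq_norm_def powr_powr)
    also have "\<dots> \<le> 1 powr q"
      using K1[OF that] assms(3) by (intro powr_mono2) (auto simp: Lq_norm_def)
    finally show ?thesis by simp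
  qed
  from kernel_greedy_sequence[OF assms(1-4) this m]
  obtain \<xi> where \<xi>: "\<forall>\<mu>\<in>{1..m}. \<xi> \<mu> \<in> space M"
    and le: "(\<integral>y. \<bar>\<Sum>\<mu>=1..m. ?J y - K (\<xi> \<mu>) y\<bar> powr q \<partial>N)
        \<le> (if real m \<le> 4 * q then 2 * real m else 4 * sqrt (q * real m)) powr q" (is "?I \<le> ?R powr q")
    by blast
  have "2 * real m \<le> 4 * sqrt (q * real m)" if "real m \<le> 4 * q"
    using that by (rule two_mult_le_four_sqrt[rotated]) simp
  then have R: "0 \<le> ?R" "?R \<le> 4 * sqrt (q * real m)" using assms(3) by auto
  \<comment> \<open>The error of the equal-weight average is the greedy sum divided by
    \<open>m\<close>, so homogeneity of the norm applies.\<close>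
  have "\<bar>?J y - (1 / real m) * (\<Sum>\<mu>=1..m. K (\<xi> \<mu>) y)\<bar> powr q
      = (1 / real m) powr q * \<bar>\<Sum>\<mu>=1..m. ?J y - K (\<xi> \<mu>) y\<bar> powr q" for y
  proof -
    have "?J y - (1 / real m) * (\<Sum>\<mu>=1..m. K (\<xi> \<mu>) y) = (1 / real m) * (\<Sum>\<mu>=1..m. ?J y - K (\<xi> \<mu>) y)"
      using m by (simp add: sum_subtractf field_simps)
    then show ?thesis by (simp only: abs_mult powr_mult) simp
  qed
  then have "discrepancy M N K q m \<xi> = ((1 / real m) powr q * ?I) powr (1 / q)"
    by (simp only: discrepancy_def Lq_norm_def integral_mult_right_zero)
  also have "\<dots> = 1 / real m * ?I powr (1 / q)"
    using assms(3) by (simp add: powr_mult powr_powr)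
  also have "\<dots> \<le> 1 / real m * (?R powr q) powr (1 / q)"
    using le assms(3) by (intro mult_left_mono powr_mono2) auto
  also have "\<dots> = 1 / real m * ?R" using assms(3) R(1) by (simp add: powr_powr)
  also have "\<dots> \<le> 1 / real m * (4 * sqrt (q * real m))" using R(2) by (intro mult_left_mono) auto
  also have "\<dots> = 4 * sqrt q * (sqrt (real m) / real m)" by (simp add: real_sqrt_mult)
  also have "sqrt (real m) / real m = real m powr (- 1 / 2)"
    using m powr_diff[of "real m" "1 / 2" 1] by (simp add: powr_half_sqrt)
  finally show ?thesis using \<xi> assms(3) by (auto simp: powr_half_sqrt)
qed

section \<open>Specialisation to Lebesgue measure\<close>

lemma sigma_finite_measure_completion:
  assumes "sigma_finite_measure M"
  shows "sigma_finite_measure (completion M)"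
proof -
  interpret sigma_finite_measure M by fact
  from sigma_finite_countable obtain A where "countable A" "A \<subseteq> sets M" "\<Union>A = space M" "\<forall>a\<in>A. emeasure M a \<noteq> \<infinity>"
    by blast
  then show ?thesis by unfold_locales (intro exI[of _ A], auto)
qed

lemma sigma_finite_measure_leb: "sigma_finite_measure (leb d)"
proof -
  interpret product_sigma_finite "\<lambda>_::nat. lborel :: real measure" ..
  show ?thesis unfolding leb_def
    by (intro sigma_finite_measure_completion sigma_finite) simp
qed

theorem theorem5p2:
  "\<exists>C::real. C > 0 \<and>
     (\<forall>(d1::nat) (d2::nat) (\<Omega>1 :: (nat \<Rightarrow> real) set) (\<Omega>2 :: (nat \<Rightarrow> real) set)
        (q::real) (K :: (nat \<Rightarrow> real) \<Rightarrow> (nat \<Rightarrow> real) \<Rightarrow> real).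
        \<Omega>1 \<in> sets (leb d1) \<longrightarrow> \<Omega>2 \<in> sets (leb d2) \<longrightarrow>
        2 \<le> q \<longrightarrow>
        K \<in> kernel_class (leb_on d1 \<Omega>1) (leb_on d2 \<Omega>2) q \<longrightarrow>
        emeasure (leb d1) \<Omega>1 = 1 \<longrightarrow>
        (\<forall>x\<in>\<Omega>1. Lq_norm q (leb_on d2 \<Omega>2) (K x) \<le> 1) \<longrightarrow>
        kernel_integral (leb_on d1 \<Omega>1) K
          \<in> kernel_space (leb_on d1 \<Omega>1) (leb_on d2 \<Omega>2) K q \<longrightarrow>
        (\<forall>m::nat. m \<ge> 1 \<longrightarrow>
          (\<exists>\<xi> :: nat \<Rightarrow> (nat \<Rightarrow> real). (\<forall>\<mu>\<in>{1..m}. \<xi> \<mu> \<in> \<Omega>1) \<and>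
             discrepancy (leb_on d1 \<Omega>1) (leb_on d2 \<Omega>2) K q m \<xi>
               \<le> C * q powr (1/2) * real m powr (-1/2))))"
proof (intro exI[of _ 4] conjI allI impI)
  fix d1 d2 :: nat and \<Omega>1 \<Omega>2 :: "(nat \<Rightarrow> real) set" and q :: real
    and K :: "(nat \<Rightarrow> real) \<Rightarrow> (nat \<Rightarrow> real) \<Rightarrow> real" and m :: nat
  assume \<Omega>: "\<Omega>1 \<in> sets (leb d1)" "\<Omega>2 \<in> sets (leb d2)" and q: "2 \<le> q"
    and K: "K \<in> kernel_class (leb_on d1 \<Omega>1) (leb_on d2 \<Omega>2) q"
    and 1: "emeasure (leb d1) \<Omega>1 = 1"
    and K1: "\<forall>x\<in>\<Omega>1. Lq_norm q (leb_on d2 \<Omega>2) (K x) \<le> 1" and m: "1 \<le> m"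
  have space: "space (leb_on d1 \<Omega>1) = \<Omega>1" using \<Omega> by simp
  have "emeasure (leb_on d1 \<Omega>1) \<Omega>1 = 1"
    using \<Omega> 1 by (subst emeasure_restrict_space) (auto simp: sets.Int_space_eq2)
  then have "emeasure (leb_on d1 \<Omega>1) (space (leb_on d1 \<Omega>1)) = 1" by (simp only: space)
  from discrepancy_greedy[OF this _ q K _ m] K1 \<Omega>
  show "\<exists>\<xi>. (\<forall>\<mu>\<in>{1..m}. \<xi> \<mu> \<in> \<Omega>1) \<and>
      discrepancy (leb_on d1 \<Omega>1) (leb_on d2 \<Omega>2) K q m \<xi> \<le> 4 * q powr (1 / 2) * real m powr (- 1 / 2)"
    by (simp add: space sigma_finite_measure_restrict_space sigma_finite_measure_leb)
qed simp

end
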